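(* Let $\alpha: I\to E^3$ be a Frenet curve with Frenet frame $\{T,N,B\}$, curvature $\kappa$ and torsion $\tau$, and let $\beta$ be an $X$-direction curve of $\alpha$, where $X=aT+bN+cB$ with $a,b,c$ smooth functions of $s$ satisfying $a^2+b^2+c^2=1$. Then $\beta$ is a Bertrand-direction curve of $\alpha$ if and only if $$a=\cos\theta,\qquad b=0,\qquad c=\sin\theta,$$ where $\theta$ is the constant angle between the tangent lines of the curves $\alpha$ and $\beta$.
   Context: $I\subset\mathbb{R}$ is an open interval and $E^3$ is Euclidean 3-space. A unit speed curve $\alpha:I\to E^3$ is a Frenet curve if its curvature $\kappa=\|\alpha''\|$ is nowhere zero; then $T=\alpha'$, $\alpha''=\kappa N$, $B=T\times N$, and $T'=\kappa N$, $N'=-\kappa T+\tau B$, $B'=-\tau N$, where $\tau$ is the torsion. For a unit vector valued function $X(s)=a(s)T(s)+b(s)N(s)+c(s)B(s)$ with $a,b,c$ smooth and $a^2+b^2+c^2=1$, an $X$-direction curve of $\alpha$ is a curve $\beta:I\to E^3$ that is an integral curve of $X$, i.e. $\beta'(s)=X(s)$; the arc length parameter $s$ of $\alpha$ is then also an arc length parameter of $\beta$. The Frenet vectors and curvatures of $\beta$ are denoted $\{\overline T,\overline N,\overline B\}$, $\overline\kappa,\overline\tau$. An $X$-direction curve $\beta$ of $\alpha$ is called a Bertrand-direction curve of $\alpha$ if $\beta$ is a Bertrand curve of $\alpha$ and $\alpha$ is a Bertrand partner curve of $\beta$; this relation is used in the form $\overline N=N$ at corresponding parameter values.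
   Formalization: β is assumed to be a Frenet curve, and the Bertrand relation is taken as N̄ = ±N, since N̄ = N fails e.g. for θ = π, β = −α; for N̄ = N itself the equivalence is stated with the added condition κ cos θ − τ sin θ > 0. *)

theory Defs
  imports "HOL-Analysis.Analysis"
begin

definition vderiv :: "(real \<Rightarrow> 'a::real_normed_vector) \<Rightarrow> real \<Rightarrow> 'a" where
  "vderiv f = (\<lambda>s. vector_derivative f (at s))"

text \<open>Meant for open \<open>I\<close>: derivatives are two-sided, taken at points of \<open>I\<close>.\<close>

definition smooth_fun_on :: "real set \<Rightarrow> (real \<Rightarrow> 'a::real_normed_vector) \<Rightarrow> bool" where
  "smooth_fun_on I f \<longleftrightarrow> (\<forall>n. \<forall>s\<in>I. (vderiv ^^ n) f differentiable (at s))"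

definition tangent :: "(real \<Rightarrow> real^3) \<Rightarrow> real \<Rightarrow> real^3" where
  "tangent \<gamma> s = vderiv \<gamma> s"

definition curvature :: "(real \<Rightarrow> real^3) \<Rightarrow> real \<Rightarrow> real" where
  "curvature \<gamma> s = norm (vderiv (vderiv \<gamma>) s)"

definition principal_normal :: "(real \<Rightarrow> real^3) \<Rightarrow> real \<Rightarrow> real^3" where
  "principal_normal \<gamma> s = (1 / curvature \<gamma> s) *\<^sub>R vderiv (vderiv \<gamma>) s"

definition binormal :: "(real \<Rightarrow> real^3) \<Rightarrow> real \<Rightarrow> real^3" where
  "binormal \<gamma> s = cross3 (tangent \<gamma> s) (principal_normal \<gamma> s)"

text \<open>The coefficient of \<open>B\<close> in \<open>N' = - \<kappa> T + \<tau> B\<close>.\<close>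

definition torsion :: "(real \<Rightarrow> real^3) \<Rightarrow> real \<Rightarrow> real" where
  "torsion \<gamma> s = vderiv (principal_normal \<gamma>) s \<bullet> binormal \<gamma> s"

definition frenet_curve :: "real set \<Rightarrow> (real \<Rightarrow> real^3) \<Rightarrow> bool" where
  "frenet_curve I \<gamma> \<longleftrightarrow>
     smooth_fun_on I \<gamma> \<and>
     (\<forall>s\<in>I. norm (tangent \<gamma> s) = 1) \<and>
     (\<forall>s\<in>I. curvature \<gamma> s \<noteq> 0)"

text \<open>\<open>\<beta>\<close> is an integral curve of the unit field \<open>X = a T + b N + c B\<close> along \<open>\<alpha>\<close>.\<close>

definition direction_curve ::
  "real set \<Rightarrow> (real \<Rightarrow> real^3) \<Rightarrow> (real \<Rightarrow> real) \<Rightarrow> (real \<Rightarrow> real) \<Rightarrow> (real \<Rightarrow> real) \<Rightarrow>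
    (real \<Rightarrow> real^3) \<Rightarrow> bool" where
  "direction_curve I \<alpha> a b c \<beta> \<longleftrightarrow>
     smooth_fun_on I a \<and> smooth_fun_on I b \<and> smooth_fun_on I c \<and>
     (\<forall>s\<in>I. (a s)\<^sup>2 + (b s)\<^sup>2 + (c s)\<^sup>2 = 1) \<and>
     (\<forall>s\<in>I. (\<beta> has_vector_derivative
        a s *\<^sub>R tangent \<alpha> s + b s *\<^sub>R principal_normal \<alpha> s + c s *\<^sub>R binormal \<alpha> s) (at s))"

text \<open>
  The Bertrand relation: at corresponding parameter values the principal normal lines have
  the same direction.  As the curvature is a norm here, \<open>principal_normal\<close> always points along
  the second derivative, so equality of these lines fixes the normals only up to sign.  The
  sign cannot be avoided: for \<open>a = cos \<theta>\<close>, \<open>b = 0\<close>, \<open>c = sin \<theta>\<close> one has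
  \<open>\<beta>'' = (\<kappa> cos \<theta> - \<tau> sin \<theta>) N\<close>, and the coefficient may be negative.  The identity
  of the normals including orientation is \<open>oriented_bertrand_direction_curve\<close> below.
\<close>

definition bertrand_direction_curve ::
  "real set \<Rightarrow> (real \<Rightarrow> real^3) \<Rightarrow> (real \<Rightarrow> real) \<Rightarrow> (real \<Rightarrow> real) \<Rightarrow> (real \<Rightarrow> real) \<Rightarrow>
    (real \<Rightarrow> real^3) \<Rightarrow> bool" where
  "bertrand_direction_curve I \<alpha> a b c \<beta> \<longleftrightarrow>
     direction_curve I \<alpha> a b c \<beta> \<and> frenet_curve I \<alpha> \<and> frenet_curve I \<beta> \<and>
     (\<forall>s\<in>I. principal_normal \<beta> s = principal_normal \<alpha> s \<or>
            principal_normal \<beta> s = - principal_normal \<alpha> s)"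

definition oriented_bertrand_direction_curve ::
  "real set \<Rightarrow> (real \<Rightarrow> real^3) \<Rightarrow> (real \<Rightarrow> real) \<Rightarrow> (real \<Rightarrow> real) \<Rightarrow> (real \<Rightarrow> real) \<Rightarrow>
    (real \<Rightarrow> real^3) \<Rightarrow> bool" where
  "oriented_bertrand_direction_curve I \<alpha> a b c \<beta> \<longleftrightarrow>
     direction_curve I \<alpha> a b c \<beta> \<and> frenet_curve I \<alpha> \<and> frenet_curve I \<beta> \<and>
     (\<forall>s\<in>I. principal_normal \<beta> s = principal_normal \<alpha> s)"

end

theory Submission
  imports Defs
begin

text \<open>
  Write \<open>U\<close> for the tangent of \<open>\<beta>\<close>. In the orthonormal frame \<open>T, N, B\<close> of \<open>\<alpha>\<close> the coefficients of
  \<open>U\<close> are \<open>a = T \<bullet> U\<close>, \<open>b = N \<bullet> U\<close>, \<open>c = B \<bullet> U\<close>. If the principal normal of \<open>\<beta>\<close> is \<open>\<plusminus>N\<close>, then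
  \<open>b = 0\<close>, because a principal normal is orthogonal to its tangent. Both \<open>T'\<close> and \<open>B'\<close> are multiples
  of \<open>N\<close>, hence orthogonal to \<open>U\<close>, and \<open>U'\<close> is a multiple of \<open>N\<close>, hence orthogonal to \<open>T\<close> and \<open>B\<close>;
  so \<open>a\<close> and \<open>c\<close> have derivative zero and are constant on the interval (lemma
  \<open>tangent_angles_constant\<close>). A constant point \<open>(a, c)\<close> of the unit circle is
  \<open>(cos \<theta>, sin \<theta>)\<close>.

  Conversely, differentiating \<open>U = cos \<theta> T + sin \<theta> B\<close> gives
  \<open>U' = (\<kappa> cos \<theta> - \<tau> sin \<theta>) N\<close> (lemma \<open>second_derivative_constant_angle\<close>). The principal normal of
  \<open>\<beta>\<close> is therefore \<open>N\<close> or \<open>-N\<close>, according to the sign of this coefficient, which cannot vanish since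
  \<open>\<beta>\<close> is a Frenet curve. That sign is exactly the difference between the oriented and the unoriented
  relation.
\<close>

section \<open>Frenet equations\<close>

text \<open>
  By the product rule. Applied to the unit vectors \<open>T\<close> and \<open>N\<close> with themselves, this makes each of
  them orthogonal to its derivative.
\<close>

lemma constant_inner_derivative:
  fixes u v :: "real \<Rightarrow> 'a::real_inner"
  assumes "open I" "s \<in> I"
    and "\<And>t. t \<in> I \<Longrightarrow> u t \<bullet> v t = k"
    and "(u has_vector_derivative u') (at s)" "(v has_vector_derivative v') (at s)"
  shows "u s \<bullet> v' + u' \<bullet> v s = 0"
proof -
  have "((\<lambda>t. u t \<bullet> v t) has_vector_derivative u s \<bullet> v' + u' \<bullet> v s) (at s)"
    using bounded_bilinear.has_vector_derivative[OF bounded_bilinear_inner assms(4,5)] .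
  moreover have "((\<lambda>t. u t \<bullet> v t) has_vector_derivative 0) (at s)"
    by (rule has_vector_derivative_transform_within_open[OF has_vector_derivative_const[of k]
          assms(1,2)]) (simp add: assms(3))
  ultimately show ?thesis
    by (rule vector_derivative_unique_at)
qed

lemma differentiable_vderiv:
  "f differentiable (at s) \<Longrightarrow> (f has_vector_derivative vderiv f s) (at s)"
  by (simp add: vderiv_def vector_derivative_works)

lemma smooth_fun_on_vderiv:
  "smooth_fun_on I f \<Longrightarrow> s \<in> I \<Longrightarrow> vderiv f differentiable (at s)"
  "smooth_fun_on I f \<Longrightarrow> s \<in> I \<Longrightarrow> vderiv (vderiv f) differentiable (at s)"
  unfolding smooth_fun_on_def
  by (drule spec[of _ 1], simp) (drule spec[of _ 2], simp add: numeral_2_eq_2)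

context
  fixes I :: "real set" and \<gamma> :: "real \<Rightarrow> real^3" and s :: real
  assumes frenet: "frenet_curve I \<gamma>" and s: "s \<in> I"
begin

lemma curvature_pos: "curvature \<gamma> s > 0"
  using frenet s by (auto simp: frenet_curve_def curvature_def)

lemma principal_normal_unit: "principal_normal \<gamma> s \<bullet> principal_normal \<gamma> s = 1"
  using curvature_pos
  by (simp add: principal_normal_def curvature_def flip: power2_norm_eq_inner power2_eq_square)

lemma has_vector_derivative_tangent:
  "(tangent \<gamma> has_vector_derivative curvature \<gamma> s *\<^sub>R principal_normal \<gamma> s) (at s)"
proof -
  have "tangent \<gamma> = vderiv \<gamma>"
    by (simp add: tangent_def fun_eq_iff)
  moreover have "vderiv (vderiv \<gamma>) s = curvature \<gamma> s *\<^sub>R principal_normal \<gamma> s"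
    using curvature_pos by (simp add: principal_normal_def)
  ultimately show ?thesis
    using differentiable_vderiv[OF smooth_fun_on_vderiv(1)] frenet s
    by (metis frenet_curve_def)
qed

lemma tangent_unit: "tangent \<gamma> s \<bullet> tangent \<gamma> s = 1"
  using frenet s by (simp add: frenet_curve_def flip: power2_norm_eq_inner)

text \<open>
  The curvature is a norm, and the norm is differentiable away from the origin. Nonzero
  curvature is thus needed twice: to differentiate \<open>\<kappa>\<close> itself and to divide by it.
\<close>

lemma has_vector_derivative_principal_normal:
  "(principal_normal \<gamma> has_vector_derivative vderiv (principal_normal \<gamma>) s) (at s)"
proof (rule differentiable_vderiv)
  let ?A = "vderiv (vderiv \<gamma>)"
  have A: "?A differentiable (at s)"
    using frenet s smooth_fun_on_vderiv(2) by (auto simp: frenet_curve_def)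
  have A0: "?A s \<noteq> 0"
    using curvature_pos by (auto simp: curvature_def)
  have "(\<lambda>t. norm (?A t)) differentiable (at s)"
    using differentiable_compose[of norm ?A s UNIV] differentiable_norm_at[OF A0] A by simp
  then have "(\<lambda>t. inverse (norm (?A t)) *\<^sub>R ?A t) differentiable (at s)"
    using A A0 by (intro differentiable_scaleR differentiable_inverse) auto
  then show "principal_normal \<gamma> differentiable (at s)"
    by (simp add: principal_normal_def[abs_def] curvature_def[abs_def] inverse_eq_divide)
qed

end

text \<open>The derivative of the constant \<open>T \<bullet> T\<close> is \<open>2\<kappa> T \<bullet> N\<close>, and \<open>\<kappa>\<close> does not vanish.\<close>

lemma tangent_orthogonal_principal_normal:
  assumes "open I" "frenet_curve I \<gamma>" "s \<in> I"
  shows "tangent \<gamma> s \<bullet> principal_normal \<gamma> s = 0"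
proof -
  have "tangent \<gamma> s \<bullet> (curvature \<gamma> s *\<^sub>R principal_normal \<gamma> s) +
        (curvature \<gamma> s *\<^sub>R principal_normal \<gamma> s) \<bullet> tangent \<gamma> s = 0"
    using constant_inner_derivative[OF assms(1,3), of "tangent \<gamma>" "tangent \<gamma>" 1]
      tangent_unit[OF assms(2)] has_vector_derivative_tangent[OF assms(2,3)] by blast
  then show ?thesis
    using curvature_pos[OF assms(2,3)] by (simp add: inner_commute)
qed

text \<open>
  The derivative of \<open>B = T \<times> N\<close> is \<open>T \<times> N'\<close>, as \<open>T'\<close> is parallel to \<open>N\<close>. Since \<open>N\<close> is orthogonal
  to both \<open>T\<close> and \<open>N'\<close>, this cross product is parallel to \<open>N\<close>; its component along \<open>N\<close> is
  the triple product \<open>N \<bullet> (T \<times> N') = -\<tau>\<close>.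
\<close>

lemma has_vector_derivative_binormal:
  assumes "open I" "frenet_curve I \<gamma>" "s \<in> I"
  shows "(binormal \<gamma> has_vector_derivative - torsion \<gamma> s *\<^sub>R principal_normal \<gamma> s) (at s)"
proof -
  define T where "T = tangent \<gamma> s"
  define N where "N = principal_normal \<gamma> s"
  define N' where "N' = vderiv (principal_normal \<gamma>) s"
  have NN: "N \<bullet> N = 1"
    using principal_normal_unit[OF assms(2,3)] by (simp add: N_def)
  have NT: "N \<bullet> T = 0"
    using tangent_orthogonal_principal_normal[OF assms] by (simp add: N_def T_def inner_commute)
  have "N \<bullet> N' + N' \<bullet> N = 0"
    unfolding N_def N'_def
    using constant_inner_derivative[OF assms(1,3), of "principal_normal \<gamma>" "principal_normal \<gamma>" 1]
      principal_normal_unit[OF assms(2)] has_vector_derivative_principal_normal[OF assms(2,3)] by blast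
  then have NN': "N \<bullet> N' = 0"
    by (simp add: inner_commute)
  have "cross3 N (cross3 T N') = 0"
    using NT NN' by (simp add: Lagrange)
  then have "(N \<bullet> cross3 T N') *\<^sub>R N = cross3 T N'"
    using Lagrange[of N N "cross3 T N'"] NN by simp
  moreover have "N \<bullet> cross3 T N' = - (N' \<bullet> cross3 T N)"
    by (metis cross_skew cross_triple inner_commute inner_minus_right)
  moreover have "N' \<bullet> cross3 T N = torsion \<gamma> s"
    by (simp add: torsion_def binormal_def N'_def T_def N_def)
  ultimately have TN': "cross3 T N' = - torsion \<gamma> s *\<^sub>R N"
    by simp
  have "((\<lambda>t. cross3 (tangent \<gamma> t) (principal_normal \<gamma> t)) has_vector_derivative
          cross3 T N' + cross3 (curvature \<gamma> s *\<^sub>R N) N) (at s)"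
    unfolding T_def N_def N'_def
    using bounded_bilinear.has_vector_derivative[OF
        bilinear_conv_bounded_bilinear[THEN iffD1, OF bilinear_cross]
        has_vector_derivative_tangent[OF assms(2,3)] has_vector_derivative_principal_normal[OF assms(2,3)]] .
  then show ?thesis
    by (simp add: binormal_def[abs_def] TN' cross_mult_left cross_refl flip: N_def)
qed

section \<open>Direction curves\<close>

lemma direction_curve_tangent:
  assumes "direction_curve I \<alpha> a b c \<beta>" "s \<in> I"
  shows "tangent \<beta> s =
    a s *\<^sub>R tangent \<alpha> s + b s *\<^sub>R principal_normal \<alpha> s + c s *\<^sub>R binormal \<alpha> s"
  unfolding tangent_def vderiv_def
  by (rule vector_derivative_at) (use assms in \<open>simp add: direction_curve_def tangent_def vderiv_def\<close>)

lemma direction_curve_coefficients: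
  assumes "open I" "frenet_curve I \<alpha>" "direction_curve I \<alpha> a b c \<beta>" "s \<in> I"
  shows "a s = tangent \<alpha> s \<bullet> tangent \<beta> s"
    and "b s = principal_normal \<alpha> s \<bullet> tangent \<beta> s"
    and "c s = binormal \<alpha> s \<bullet> tangent \<beta> s"
proof -
  note TT = tangent_unit[OF assms(2,4)]
  note NN = principal_normal_unit[OF assms(2,4)]
  note TN = tangent_orthogonal_principal_normal[OF assms(1,2,4)]
  have NT: "principal_normal \<alpha> s \<bullet> tangent \<alpha> s = 0"
    using TN by (simp add: inner_commute)
  have B: "binormal \<alpha> s \<bullet> tangent \<alpha> s = 0" "binormal \<alpha> s \<bullet> principal_normal \<alpha> s = 0"
    "tangent \<alpha> s \<bullet> binormal \<alpha> s = 0" "principal_normal \<alpha> s \<bullet> binormal \<alpha> s = 0"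
    by (simp_all add: binormal_def dot_cross_self)
  have BB: "binormal \<alpha> s \<bullet> binormal \<alpha> s = 1"
    using TT NN TN
    by (simp add: binormal_def dot_cross power2_eq_square inner_commute)
  show "a s = tangent \<alpha> s \<bullet> tangent \<beta> s"
    "b s = principal_normal \<alpha> s \<bullet> tangent \<beta> s"
    "c s = binormal \<alpha> s \<bullet> tangent \<beta> s"
    using direction_curve_tangent[OF assms(3,4)] TT NN TN NT B BB
    by (simp_all add: inner_add_right)
qed

text \<open>
  For curves with parallel principal normals, each of \<open>T'\<close>, \<open>B'\<close>, \<open>U'\<close> is a multiple of the common
  normal direction, which is orthogonal to \<open>T\<close>, \<open>B\<close> and \<open>U\<close>. Both terms of the
  derivative of \<open>T \<bullet> U\<close> and of \<open>B \<bullet> U\<close> therefore vanish.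
\<close>

lemma tangent_angles_constant:
  assumes I: "open I" "is_interval I"
    and \<alpha>: "frenet_curve I \<alpha>" and \<beta>: "frenet_curve I \<beta>"
    and par: "\<And>s. s \<in> I \<Longrightarrow> principal_normal \<beta> s = principal_normal \<alpha> s \<or>
                            principal_normal \<beta> s = - principal_normal \<alpha> s"
  obtains p q where "\<And>s. s \<in> I \<Longrightarrow> tangent \<alpha> s \<bullet> tangent \<beta> s = p"
    and "\<And>s. s \<in> I \<Longrightarrow> binormal \<alpha> s \<bullet> tangent \<beta> s = q"
proof -
  have orth: "principal_normal \<alpha> s \<bullet> tangent \<beta> s = 0" "tangent \<alpha> s \<bullet> principal_normal \<beta> s = 0"
      "binormal \<alpha> s \<bullet> principal_normal \<beta> s = 0" if s: "s \<in> I" for s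
    using par[OF s] tangent_orthogonal_principal_normal[OF I(1) \<alpha> s]
      tangent_orthogonal_principal_normal[OF I(1) \<beta> s]
    by (auto simp: inner_commute binormal_def dot_cross_self)
  have "\<exists>p. \<forall>s\<in>I. tangent \<alpha> s \<bullet> tangent \<beta> s = p"
  proof -
    have "((\<lambda>t. tangent \<alpha> t \<bullet> tangent \<beta> t) has_vector_derivative 0) (at s within I)"
      if s: "s \<in> I" for s
      using bounded_bilinear.has_vector_derivative[OF bounded_bilinear_inner
          has_vector_derivative_tangent[OF \<alpha> s] has_vector_derivative_tangent[OF \<beta> s]]
        orth[OF s] by (auto intro: has_vector_derivative_at_within)
    from has_vector_derivative_zero_constant[OF is_interval_convex[OF I(2)] this]
    show ?thesis by blast
  qed
  moreover have "\<exists>q. \<forall>s\<in>I. binormal \<alpha> s \<bullet> tangent \<beta> s = q"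
  proof -
    have "((\<lambda>t. binormal \<alpha> t \<bullet> tangent \<beta> t) has_vector_derivative 0) (at s within I)"
      if s: "s \<in> I" for s
      using bounded_bilinear.has_vector_derivative[OF bounded_bilinear_inner
          has_vector_derivative_binormal[OF I(1) \<alpha> s] has_vector_derivative_tangent[OF \<beta> s]]
        orth[OF s] by (auto intro: has_vector_derivative_at_within)
    from has_vector_derivative_zero_constant[OF is_interval_convex[OF I(2)] this]
    show ?thesis by blast
  qed
  ultimately show ?thesis
    using that by metis
qed

text \<open>
  The angle does not depend on the parameter, so only \<open>T' = \<kappa>N\<close> and \<open>B' = -\<tau>N\<close> contribute to the
  derivative.
\<close>

lemma second_derivative_constant_angle:
  assumes I: "open I" and \<alpha>: "frenet_curve I \<alpha>" and \<beta>: "frenet_curve I \<beta>" and s: "s \<in> I"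
    and tan: "\<And>t. t \<in> I \<Longrightarrow> tangent \<beta> t = cos \<theta> *\<^sub>R tangent \<alpha> t + sin \<theta> *\<^sub>R binormal \<alpha> t"
  shows "curvature \<beta> s *\<^sub>R principal_normal \<beta> s =
    (curvature \<alpha> s * cos \<theta> - torsion \<alpha> s * sin \<theta>) *\<^sub>R principal_normal \<alpha> s"
proof -
  have "((\<lambda>t. cos \<theta> *\<^sub>R tangent \<alpha> t + sin \<theta> *\<^sub>R binormal \<alpha> t) has_vector_derivative
      cos \<theta> *\<^sub>R (curvature \<alpha> s *\<^sub>R principal_normal \<alpha> s) +
      sin \<theta> *\<^sub>R (- torsion \<alpha> s *\<^sub>R principal_normal \<alpha> s)) (at s)"
    by (intro has_vector_derivative_add
        bounded_linear.has_vector_derivative[OF bounded_linear_scaleR_right]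
        has_vector_derivative_tangent[OF \<alpha> s] has_vector_derivative_binormal[OF I \<alpha> s])
  then have "(tangent \<beta> has_vector_derivative
      cos \<theta> *\<^sub>R (curvature \<alpha> s *\<^sub>R principal_normal \<alpha> s) +
      sin \<theta> *\<^sub>R (- torsion \<alpha> s *\<^sub>R principal_normal \<alpha> s)) (at s)"
    by (rule has_vector_derivative_transform_within_open[OF _ I s]) (simp add: tan)
  from vector_derivative_unique_at[OF has_vector_derivative_tangent[OF \<beta> s] this]
  show ?thesis
    by (simp add: algebra_simps)
qed

text \<open>Comparing norms gives \<open>k = \<bar>l\<bar>\<close>, so only the sign of \<open>l\<close> is left undetermined.\<close>

lemma positive_multiple_of_unit:
  fixes u v :: "'a::real_inner"
  assumes "u \<bullet> u = 1" "v \<bullet> v = 1" "k > 0" "k *\<^sub>R u = l *\<^sub>R v"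
  shows "u = v \<or> u = - v" and "u = v \<longleftrightarrow> l > 0"
proof -
  have nu: "norm u = 1" "norm v = 1"
    using assms(1,2) by (simp_all add: norm_eq_sqrt_inner)
  have "norm (k *\<^sub>R u) = norm (l *\<^sub>R v)"
    using assms(4) by simp
  then have "k = \<bar>l\<bar>"
    using nu assms(3) by simp
  then consider "l = k" | "l = - k"
    by linarith
  then have *: "u = v \<and> l > 0 \<or> u = - v \<and> l < 0"
  proof cases
    case 1
    then show ?thesis using assms(3,4) by simp
  next
    case 2
    then have "k *\<^sub>R u = k *\<^sub>R (- v)" using assms(4) by simp
    then have "u = - v" using assms(3) by (metis less_irrefl scaleR_left_imp_eq)
    then show ?thesis using 2 assms(3) by simp
  qed
  moreover have "- v \<noteq> v"
    using assms(2) by (metis inner_minus_left one_neq_neg_one)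
  ultimately show "u = v \<or> u = - v" "u = v \<longleftrightarrow> l > 0"
    by auto
qed

section \<open>Bertrand-direction curves\<close>

lemma bertrand_imp_constant_angle:
  assumes I: "open I" "is_interval I" "I \<noteq> {}"
    and \<alpha>: "frenet_curve I \<alpha>" and \<beta>: "frenet_curve I \<beta>" and dir: "direction_curve I \<alpha> a b c \<beta>"
    and par: "\<And>s. s \<in> I \<Longrightarrow> principal_normal \<beta> s = principal_normal \<alpha> s \<or>
                            principal_normal \<beta> s = - principal_normal \<alpha> s"
  shows "\<exists>\<theta>. \<forall>s\<in>I. a s = cos \<theta> \<and> b s = 0 \<and> c s = sin \<theta>"
proof -
  have b: "b s = 0" if s: "s \<in> I" for s
    using par[OF s] tangent_orthogonal_principal_normal[OF I(1) \<beta> s]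
      direction_curve_coefficients(2)[OF I(1) \<alpha> dir s]
    by (auto simp: inner_commute)
  obtain p q where "\<And>s. s \<in> I \<Longrightarrow> tangent \<alpha> s \<bullet> tangent \<beta> s = p"
      "\<And>s. s \<in> I \<Longrightarrow> binormal \<alpha> s \<bullet> tangent \<beta> s = q"
    using tangent_angles_constant[OF I(1,2) \<alpha> \<beta> par] by metis
  then have ac: "a s = p" "c s = q" if "s \<in> I" for s
    using direction_curve_coefficients(1,3)[OF I(1) \<alpha> dir that] that by simp_all
  obtain s0 where s0: "s0 \<in> I"
    using I(3) by auto
  then have "(a s0)\<^sup>2 + (b s0)\<^sup>2 + (c s0)\<^sup>2 = 1"
    using dir by (simp add: direction_curve_def)
  then have "p\<^sup>2 + q\<^sup>2 = 1"
    using ac[OF s0] b[OF s0] by simp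
  then obtain \<theta> where "p = cos \<theta>" "q = sin \<theta>"
    by (metis sincos_total_2pi)
  then show ?thesis
    using ac b by auto
qed

lemma constant_angle_principal_normal:
  assumes I: "open I" and \<alpha>: "frenet_curve I \<alpha>" and \<beta>: "frenet_curve I \<beta>"
    and dir: "direction_curve I \<alpha> a b c \<beta>" and s: "s \<in> I"
    and abc: "\<forall>s\<in>I. a s = cos \<theta> \<and> b s = 0 \<and> c s = sin \<theta>"
  shows "principal_normal \<beta> s = principal_normal \<alpha> s \<or>
         principal_normal \<beta> s = - principal_normal \<alpha> s"
    and "principal_normal \<beta> s = principal_normal \<alpha> s \<longleftrightarrow>
         curvature \<alpha> s * cos \<theta> - torsion \<alpha> s * sin \<theta> > 0"
proof -
  have "curvature \<beta> s *\<^sub>R principal_normal \<beta> s =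
    (curvature \<alpha> s * cos \<theta> - torsion \<alpha> s * sin \<theta>) *\<^sub>R principal_normal \<alpha> s"
    using second_derivative_constant_angle[OF I \<alpha> \<beta> s]
      direction_curve_tangent[OF dir] abc by simp
  note unit = positive_multiple_of_unit[OF principal_normal_unit[OF \<beta> s]
      principal_normal_unit[OF \<alpha> s] curvature_pos[OF \<beta> s] this]
  show "principal_normal \<beta> s = principal_normal \<alpha> s \<or>
        principal_normal \<beta> s = - principal_normal \<alpha> s"
    by (rule unit(1))
  show "principal_normal \<beta> s = principal_normal \<alpha> s \<longleftrightarrow>
        curvature \<alpha> s * cos \<theta> - torsion \<alpha> s * sin \<theta> > 0"
    by (rule unit(2))
qed

theorem proposition5p2:
  fixes I :: "real set"
    and \<alpha> \<beta> :: "real \<Rightarrow> real^3"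
    and a b c :: "real \<Rightarrow> real"
  assumes "open I" and "is_interval I" and "I \<noteq> {}"
    and "frenet_curve I \<alpha>"
    and "frenet_curve I \<beta>"
    and "direction_curve I \<alpha> a b c \<beta>"
  shows "(bertrand_direction_curve I \<alpha> a b c \<beta> \<longleftrightarrow>
           (\<exists>\<theta>. \<forall>s\<in>I. a s = cos \<theta> \<and> b s = 0 \<and> c s = sin \<theta> \<and>
                     tangent \<alpha> s \<bullet> tangent \<beta> s = cos \<theta>)) \<and>
         (oriented_bertrand_direction_curve I \<alpha> a b c \<beta> \<longleftrightarrow>
           (\<exists>\<theta>. \<forall>s\<in>I. a s = cos \<theta> \<and> b s = 0 \<and> c s = sin \<theta> \<and>
                     tangent \<alpha> s \<bullet> tangent \<beta> s = cos \<theta> \<and>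
                     curvature \<alpha> s * cos \<theta> - torsion \<alpha> s * sin \<theta> > 0))"
proof -
  note angle = bertrand_imp_constant_angle[OF assms]
  note normal = constant_angle_principal_normal[OF assms(1,4,5,6)]
  have cos_angle: "tangent \<alpha> s \<bullet> tangent \<beta> s = cos \<theta>" if "s \<in> I" "a s = cos \<theta>" for s \<theta>
    using direction_curve_coefficients(1)[OF assms(1,4,6) that(1)] that(2) by simp
  have "bertrand_direction_curve I \<alpha> a b c \<beta> \<longleftrightarrow>
      (\<exists>\<theta>. \<forall>s\<in>I. a s = cos \<theta> \<and> b s = 0 \<and> c s = sin \<theta>)"
    using angle normal(1) assms(4-6) unfolding bertrand_direction_curve_def by blast
  moreover have "oriented_bertrand_direction_curve I \<alpha> a b c \<beta> \<longleftrightarrow>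
      (\<exists>\<theta>. \<forall>s\<in>I. a s = cos \<theta> \<and> b s = 0 \<and> c s = sin \<theta> \<and>
        curvature \<alpha> s * cos \<theta> - torsion \<alpha> s * sin \<theta> > 0)" (is "?L \<longleftrightarrow> ?R")
  proof
    assume ?L
    then have eq: "\<forall>s\<in>I. principal_normal \<beta> s = principal_normal \<alpha> s"
      by (simp add: oriented_bertrand_direction_curve_def)
    then obtain \<theta> where \<theta>: "\<forall>s\<in>I. a s = cos \<theta> \<and> b s = 0 \<and> c s = sin \<theta>"
      using angle by blast
    then show ?R
      using normal(2)[OF _ \<theta>] eq by blast
  next
    assume ?R
    then obtain \<theta> where \<theta>: "\<forall>s\<in>I. a s = cos \<theta> \<and> b s = 0 \<and> c s = sin \<theta>"
      and "\<forall>s\<in>I. curvature \<alpha> s * cos \<theta> - torsion \<alpha> s * sin \<theta> > 0"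
      by blast
    then show ?L
      using normal(2)[OF _ \<theta>] assms(4-6) by (simp add: oriented_bertrand_direction_curve_def)
  qed
  ultimately show ?thesis
    using cos_angle by blast
qed

end
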